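(* The ordering $<$ on $B_n$ is right invariant: if $\delta,\gamma,\sigma\in B_n$ and $\delta<\gamma$, then $\delta\sigma<\gamma\sigma$.
   Context: $D^2\subset\mathbb{C}$ is the closed unit disk, $-1=p_0<p_1<\dots<p_n<p_{n+1}=1$ are real points, $D_n=D^2\setminus\{p_1,\dots,p_n\}$ (the removed points are called holes). $B_n$ is the group of homeomorphisms $D_n\to D_n$ fixing $\partial D_n$ pointwise, up to isotopy fixed on $\partial D_n$; its elements are called braids. The product $\gamma\delta$ means "first $\gamma$, then $\delta$". $E_j$ is the straight segment from $p_{j-1}$ to $p_j$, $1\le j\le n+1$. A curve diagram of a braid $\gamma$ is $\Gamma=(\Gamma_1,\dots,\Gamma_{n+1})$ with $\Gamma_j=g(E_j)$ for a homeomorphism $g$ representing $\gamma$. Two curves are parallel if they join the same pair of points and are isotopic in $D_n$. A curve diagram $\Delta$ is transverse to a curve diagram $\Gamma$ if each curve of $\Delta$ either coincides with a (parallel) curve of $\Gamma$ or meets the curves of $\Gamma$ transversely. A $D$-disk between $\Delta$ and $\Gamma$ is a subset of $D_n$ homeomorphic to an open disk and bounded by one open segment of a curve of $\Delta$, one open segment of a curve of $\Gamma$, and two points, each of which is an intersection point of the two curves, a hole, or $\pm1$. Transverse diagrams $\Delta,\Gamma$ are reduced (with respect to each other) if there are no $D$-disks between them. Definition of $<$: given braids $\gamma,\delta$, let $\Gamma$ be a curve diagram of $\gamma$ and $\Delta$ a curve diagram of $\delta$ which is reduced with respect to $\Gamma$. The curves of $\Gamma$ cut $D_n$ into two components, the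 upper one containing $\sqrt{-1}$ and the lower one containing $-\sqrt{-1}$. Orient the curves of $\Delta$ coherently as a path from $-1$ to $1$. If all curves of $\Delta$ coincide with the corresponding curves of $\Gamma$ then $\gamma=\delta$. Otherwise let $i$ be minimal such that $\Delta_i$ does not coincide with $\Gamma_i$; then $\Delta_i$ has the same starting point as $\Gamma_i$ and first branches off $\Gamma$ either into the upper component, in which case $\delta>\gamma$, or into the lower component, in which case $\delta<\gamma$. (This does not depend on the choice of $\Gamma$ and $\Delta$.) *)

theory Defs
  imports "HOL-Analysis.Analysis" "HOL-Algebra.Group"
begin

section \<open>The braid group as a mapping class group\<close>

definition marked_points :: "nat \<Rightarrow> (nat \<Rightarrow> real) \<Rightarrow> bool" where
  "marked_points n p \<longleftrightarrow> p 0 = -1 \<and> p (n + 1) = 1 \<and> strict_mono_on {0..n+1} p"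

definition holes :: "nat \<Rightarrow> (nat \<Rightarrow> real) \<Rightarrow> complex set" where
  "holes n p = (\<lambda>j. complex_of_real (p j)) ` {1..n}"

definition punctured_disk :: "nat \<Rightarrow> (nat \<Rightarrow> real) \<Rightarrow> complex set" where
  "punctured_disk n p = cball 0 1 - holes n p"

text \<open>The boundary of the punctured disk is the unit circle; the holes do not belong to it.\<close>

definition fixes_boundary_homeo :: "nat \<Rightarrow> (nat \<Rightarrow> real) \<Rightarrow> (complex \<Rightarrow> complex) \<Rightarrow> bool" where
  "fixes_boundary_homeo n p f \<longleftrightarrow>
     (\<exists>g. homeomorphism (punctured_disk n p) (punctured_disk n p) f g) \<and>
     (\<forall>z\<in>sphere 0 1. f z = z)"

text \<open>Maps are made extensional so that a homeomorphism of the punctured disk is a single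
  element of the function type.\<close>

definition disk_homeos :: "nat \<Rightarrow> (nat \<Rightarrow> real) \<Rightarrow> (complex \<Rightarrow> complex) set" where
  "disk_homeos n p = {f \<in> extensional (punctured_disk n p). fixes_boundary_homeo n p f}"

definition isotopy_rel :: "nat \<Rightarrow> (nat \<Rightarrow> real) \<Rightarrow> ((complex \<Rightarrow> complex) \<times> (complex \<Rightarrow> complex)) set" where
  "isotopy_rel n p =
     {(f, g). f \<in> disk_homeos n p \<and> g \<in> disk_homeos n p \<and>
        homotopic_with_canon (fixes_boundary_homeo n p) (punctured_disk n p) (punctured_disk n p) f g}"

text \<open>In a product the left factor is applied first.\<close>

definition braid_group :: "nat \<Rightarrow> (nat \<Rightarrow> real) \<Rightarrow> (complex \<Rightarrow> complex) set monoid" where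
  "braid_group n p =
     \<lparr>carrier = disk_homeos n p // isotopy_rel n p,
      mult = (\<lambda>\<gamma> \<delta>. \<Union>g\<in>\<gamma>. \<Union>d\<in>\<delta>. isotopy_rel n p `` {compose (punctured_disk n p) d g}),
      one = isotopy_rel n p `` {\<lambda>z\<in>punctured_disk n p. z}\<rparr>"


lemma sphere_subset_punctured_disk:
  assumes "marked_points n p"
  shows "sphere 0 1 \<subseteq> punctured_disk n p"
proof -
  have "-1 < p j \<and> p j < 1" if "j \<in> {1..n}" for j
    using assms that strict_mono_onD[of "{0..n+1}" p 0 j] strict_mono_onD[of "{0..n+1}" p j "n+1"]
    by (auto simp: marked_points_def)
  then have "norm (complex_of_real (p j)) < 1" if "j \<in> {1..n}" for j
    using that by (simp add: abs_less_iff minus_less_iff)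
  then show ?thesis
    by (force simp: punctured_disk_def holes_def)
qed

lemma fixes_boundary_homeo_cong:
  assumes "\<And>z. z \<in> punctured_disk n p \<Longrightarrow> f z = g z" "marked_points n p"
  shows "fixes_boundary_homeo n p f \<longleftrightarrow> fixes_boundary_homeo n p g"
proof -
  have "homeomorphism (punctured_disk n p) (punctured_disk n p) f k \<longleftrightarrow>
        homeomorphism (punctured_disk n p) (punctured_disk n p) g k" for k
    using assms(1) by (intro iffI; elim homeomorphism_cong) auto
  moreover have "f z = g z" if "z \<in> sphere 0 1" for z
    using sphere_subset_punctured_disk[OF assms(2)] that assms(1) by blast
  ultimately show ?thesis
    by (auto simp: fixes_boundary_homeo_def)
qed

lemma fixes_boundary_homeo_comp:
  assumes "fixes_boundary_homeo n p f" "fixes_boundary_homeo n p g"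
  shows "fixes_boundary_homeo n p (f \<circ> g)"
  using assms unfolding fixes_boundary_homeo_def
  by (metis homeomorphism_compose comp_apply)

lemma fixes_boundary_homeo_id: "fixes_boundary_homeo n p (\<lambda>z. z)"
  unfolding fixes_boundary_homeo_def by (auto intro: homeomorphism_ident)

lemma disk_homeos_compose:
  assumes "marked_points n p" "f \<in> disk_homeos n p" "g \<in> disk_homeos n p"
  shows "compose (punctured_disk n p) f g \<in> disk_homeos n p"
  using assms fixes_boundary_homeo_comp[of n p f g]
    fixes_boundary_homeo_cong[of n p "compose (punctured_disk n p) f g" "f \<circ> g"]
  by (auto simp: disk_homeos_def compose_def)

lemma disk_homeos_id:
  assumes "marked_points n p"
  shows "(\<lambda>z\<in>punctured_disk n p. z) \<in> disk_homeos n p"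
  using fixes_boundary_homeo_cong[of n p "\<lambda>z\<in>punctured_disk n p. z" "\<lambda>z. z"]
    fixes_boundary_homeo_id assms by (auto simp: disk_homeos_def)

lemma disk_homeos_into: "f \<in> disk_homeos n p \<Longrightarrow> f \<in> punctured_disk n p \<rightarrow> punctured_disk n p"
  by (auto simp: disk_homeos_def fixes_boundary_homeo_def homeomorphism_def)

lemma disk_homeos_continuous: "f \<in> disk_homeos n p \<Longrightarrow> continuous_on (punctured_disk n p) f"
  by (auto simp: disk_homeos_def fixes_boundary_homeo_def homeomorphism_def)

lemma disk_homeos_inverse:
  assumes "marked_points n p" "f \<in> disk_homeos n p"
  shows "\<exists>g\<in>disk_homeos n p. compose (punctured_disk n p) f g = (\<lambda>z\<in>punctured_disk n p. z)"
proof -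
  let ?D = "punctured_disk n p"
  obtain g where g: "homeomorphism ?D ?D f g" and bd: "\<forall>z\<in>sphere 0 1. f z = z"
    using assms by (auto simp: disk_homeos_def fixes_boundary_homeo_def)
  have "g z = z" if "z \<in> sphere 0 1" for z
    using g bd that sphere_subset_punctured_disk[OF assms(1)]
    by (metis homeomorphism_def subsetD)
  then have "fixes_boundary_homeo n p g"
    using homeomorphism_symD[OF g] unfolding fixes_boundary_homeo_def by blast
  then have "restrict g ?D \<in> disk_homeos n p"
    using fixes_boundary_homeo_cong[of n p "restrict g ?D" g] assms(1) by (auto simp: disk_homeos_def)
  moreover have "compose ?D f (restrict g ?D) = (\<lambda>z\<in>?D. z)"
    using g by (auto simp: compose_def homeomorphism_def fun_eq_iff restrict_def)
  ultimately show ?thesis by blast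
qed

lemma compose_restrict_id:
  "f \<in> disk_homeos n p \<Longrightarrow>
     compose (punctured_disk n p) f (\<lambda>z\<in>punctured_disk n p. z) = f"
  by (auto simp: disk_homeos_def compose_def extensional_def fun_eq_iff)

lemma equiv_isotopy_rel: "equiv (disk_homeos n p) (isotopy_rel n p)"
proof (rule equivI)
  show "isotopy_rel n p \<subseteq> disk_homeos n p \<times> disk_homeos n p"
    by (auto simp: isotopy_rel_def)
  show "refl_on (disk_homeos n p) (isotopy_rel n p)"
    by (auto simp: refl_on_def isotopy_rel_def disk_homeos_continuous)
       (use disk_homeos_into in \<open>auto simp: disk_homeos_def\<close>)
  show "sym (isotopy_rel n p)"
    by (auto simp: sym_def isotopy_rel_def homotopic_with_sym)
  show "trans (isotopy_rel n p)"
    by (auto simp: trans_def isotopy_rel_def intro: homotopic_with_trans)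
qed

lemma isotopy_rel_compose:
  assumes mp: "marked_points n p"
    and g: "(g, g') \<in> isotopy_rel n p" and d: "(d, d') \<in> isotopy_rel n p"
  shows "(compose (punctured_disk n p) d g, compose (punctured_disk n p) d' g') \<in> isotopy_rel n p"
proof -
  let ?D = "punctured_disk n p" and ?P = "fixes_boundary_homeo n p"
  have mem: "g \<in> disk_homeos n p" "g' \<in> disk_homeos n p" "d \<in> disk_homeos n p" "d' \<in> disk_homeos n p"
    and hg: "homotopic_with_canon ?P ?D ?D g g'" and hd: "homotopic_with_canon ?P ?D ?D d d'"
    using g d by (auto simp: isotopy_rel_def)
  then have P: "?P g" "?P d'"
    by (auto simp: disk_homeos_def)
  have "homotopic_with_canon ?P ?D ?D (d \<circ> g) (d' \<circ> g)"
    using hd P mem by (intro homotopic_with_compose_continuous_right[where X = ?D])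
      (auto elim: homotopic_with_mono intro: fixes_boundary_homeo_comp
         disk_homeos_continuous dest: disk_homeos_into)
  moreover have "homotopic_with_canon ?P ?D ?D (d' \<circ> g) (d' \<circ> g')"
    using hg P mem by (intro homotopic_with_compose_continuous_left[where Y = ?D])
      (auto elim: homotopic_with_mono intro: fixes_boundary_homeo_comp
         disk_homeos_continuous dest: disk_homeos_into)
  ultimately have "homotopic_with_canon ?P ?D ?D (d \<circ> g) (d' \<circ> g')"
    by (rule homotopic_with_trans)
  then have "homotopic_with_canon ?P ?D ?D (compose ?D d g) (compose ?D d' g')"
  proof (rule homotopic_with_eq)
    show "?P h \<longleftrightarrow> ?P k" if "\<And>x. x \<in> topspace (top_of_set ?D) \<Longrightarrow> h x = k x" for h k
      using that by (intro fixes_boundary_homeo_cong[OF _ mp]) simp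
  qed (simp_all add: compose_def)
  then show ?thesis
    using mem mp by (auto simp: isotopy_rel_def disk_homeos_compose)
qed

lemma braid_group_mult_class:
  assumes "marked_points n p" "g \<in> disk_homeos n p" "d \<in> disk_homeos n p"
  shows "isotopy_rel n p `` {g} \<otimes>\<^bsub>braid_group n p\<^esub> isotopy_rel n p `` {d} =
         isotopy_rel n p `` {compose (punctured_disk n p) d g}"
proof -
  have "isotopy_rel n p `` {compose (punctured_disk n p) d' g'} =
        isotopy_rel n p `` {compose (punctured_disk n p) d g}"
    if "(g, g') \<in> isotopy_rel n p" "(d, d') \<in> isotopy_rel n p" for g' d'
    using isotopy_rel_compose[OF assms(1) that] equiv_class_eq[OF equiv_isotopy_rel] by metis
  moreover have "(g, g) \<in> isotopy_rel n p" "(d, d) \<in> isotopy_rel n p"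
    using assms equiv_isotopy_rel by (auto simp: equiv_def refl_on_def)
  ultimately have "(\<Union>g'\<in>isotopy_rel n p `` {g}. \<Union>d'\<in>isotopy_rel n p `` {d}.
                      isotopy_rel n p `` {compose (punctured_disk n p) d' g'}) =
                   isotopy_rel n p `` {compose (punctured_disk n p) d g}"
    by blast
  then show ?thesis
    by (simp add: braid_group_def)
qed

proposition group_braid_group:
  assumes mp: "marked_points n p"
  shows "group (braid_group n p)"
proof (rule groupI)
  let ?D = "punctured_disk n p" and ?c = "\<lambda>g. isotopy_rel n p `` {g}"
  have car: "carrier (braid_group n p) = ?c ` disk_homeos n p"
    by (auto simp: braid_group_def quotient_def)
  have one: "\<one>\<^bsub>braid_group n p\<^esub> = ?c (\<lambda>z\<in>?D. z)"
    by (simp add: braid_group_def)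
  note mult = braid_group_mult_class[OF mp] disk_homeos_compose[OF mp] disk_homeos_id[OF mp]
  show "\<one>\<^bsub>braid_group n p\<^esub> \<in> carrier (braid_group n p)"
    by (auto simp: car one mult)
  show "x \<otimes>\<^bsub>braid_group n p\<^esub> y \<in> carrier (braid_group n p)"
    if "x \<in> carrier (braid_group n p)" "y \<in> carrier (braid_group n p)" for x y
    using that by (auto simp: car mult)
  show "x \<otimes>\<^bsub>braid_group n p\<^esub> y \<otimes>\<^bsub>braid_group n p\<^esub> z =
        x \<otimes>\<^bsub>braid_group n p\<^esub> (y \<otimes>\<^bsub>braid_group n p\<^esub> z)"
    if "x \<in> carrier (braid_group n p)" "y \<in> carrier (braid_group n p)"
      "z \<in> carrier (braid_group n p)" for x y z
    using that by (auto simp: car mult compose_assoc[OF disk_homeos_into])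
  show "\<one>\<^bsub>braid_group n p\<^esub> \<otimes>\<^bsub>braid_group n p\<^esub> x = x"
    if "x \<in> carrier (braid_group n p)" for x
    using that by (auto simp: car one mult)
       (metis compose_restrict_id)+
  show "\<exists>y\<in>carrier (braid_group n p). y \<otimes>\<^bsub>braid_group n p\<^esub> x = \<one>\<^bsub>braid_group n p\<^esub>"
    if x: "x \<in> carrier (braid_group n p)" for x
  proof -
    obtain f where f: "f \<in> disk_homeos n p" "x = ?c f"
      using x by (auto simp: car)
    obtain g where g: "g \<in> disk_homeos n p" "compose ?D f g = (\<lambda>z\<in>?D. z)"
      using disk_homeos_inverse[OF mp f(1)] by blast
    then show ?thesis
      using f by (auto simp: car one mult intro!: bexI[of _ g])
  qed
qed


section \<open>Curve diagrams\<close>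

definition segment :: "(nat \<Rightarrow> real) \<Rightarrow> nat \<Rightarrow> complex set" where
  "segment p j = closed_segment (complex_of_real (p (j - 1))) (complex_of_real (p j))"

text \<open>Curves are subsets of the punctured disk, so they contain an end point at \<open>-1\<close> or \<open>1\<close>
  but not an end point at a hole.  Only the indices \<open>1, \<dots>, n + 1\<close> are meaningful.\<close>

definition curve_diagram ::
    "nat \<Rightarrow> (nat \<Rightarrow> real) \<Rightarrow> (complex \<Rightarrow> complex) \<Rightarrow> nat \<Rightarrow> complex set" where
  "curve_diagram n p g j = g ` (segment p j \<inter> punctured_disk n p)"

text \<open>Topological transversality: in a suitable chart around \<open>x\<close> the two curves are the
  coordinate axes.\<close>

definition crosses_at :: "nat \<Rightarrow> (nat \<Rightarrow> real) \<Rightarrow> complex set \<Rightarrow> complex set \<Rightarrow> complex \<Rightarrow> bool" where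
  "crosses_at n p A B x \<longleftrightarrow>
     (\<exists>U h k. open U \<and> x \<in> U \<and> U \<subseteq> punctured_disk n p \<and>
        homeomorphism U (ball 0 1) h k \<and> h x = 0 \<and>
        h ` (A \<inter> U) = {z \<in> ball 0 1. Im z = 0} \<and>
        h ` (B \<inter> U) = {z \<in> ball 0 1. Re z = 0})"

text \<open>The points \<open>-1\<close> and \<open>1\<close> are common end points, where no crossing is required.  Finiteness
  is the part of transversality at the end points: since an isotopy of the punctured disk can
  wind an end of a curve infinitely often around a hole, local crossings alone
  would allow the intersection points to accumulate at a hole.\<close>

definition meets_transversely ::
    "nat \<Rightarrow> (nat \<Rightarrow> real) \<Rightarrow> complex set \<Rightarrow> complex set \<Rightarrow> bool" where
  "meets_transversely n p A B \<longleftrightarrow>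
     finite (A \<inter> B) \<and> (\<forall>x \<in> A \<inter> B - {-1, 1}. crosses_at n p A B x)"

definition transverse ::
    "nat \<Rightarrow> (nat \<Rightarrow> real) \<Rightarrow> (nat \<Rightarrow> complex set) \<Rightarrow> (nat \<Rightarrow> complex set) \<Rightarrow> bool" where
  "transverse n p \<Delta> \<Gamma> \<longleftrightarrow>
     (\<forall>j\<in>{1..n+1}. (\<exists>k\<in>{1..n+1}. \<Delta> j = \<Gamma> k) \<or>
                   (\<forall>k\<in>{1..n+1}. meets_transversely n p (\<Delta> j) (\<Gamma> k)))"

text \<open>\<open>S\<close> is an open segment of the curve \<open>A\<close> with end points \<open>a\<close> and \<open>b\<close>, which may be holes.\<close>

definition open_segment_of :: "complex set \<Rightarrow> complex set \<Rightarrow> complex \<Rightarrow> complex \<Rightarrow> bool" where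
  "open_segment_of A S a b \<longleftrightarrow>
     (\<exists>c. arc c \<and> pathstart c = a \<and> pathfinish c = b \<and> S = c ` {0<..<1} \<and> S \<subseteq> A)"

definition D_disk ::
    "nat \<Rightarrow> (nat \<Rightarrow> real) \<Rightarrow> (nat \<Rightarrow> complex set) \<Rightarrow> (nat \<Rightarrow> complex set) \<Rightarrow> complex set \<Rightarrow> bool" where
  "D_disk n p \<Delta> \<Gamma> U \<longleftrightarrow>
     U \<subseteq> punctured_disk n p \<and> U homeomorphic (ball 0 1 :: complex set) \<and>
     (\<exists>j\<in>{1..n+1}. \<exists>k\<in>{1..n+1}. \<exists>S T a b.
        open_segment_of (\<Delta> j) S a b \<and> open_segment_of (\<Gamma> k) T a b \<and> S \<inter> T = {} \<and>
        frontier U = S \<union> T \<union> {a, b} \<and>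
        {a, b} \<subseteq> (\<Delta> j \<inter> \<Gamma> k) \<union> holes n p \<union> {-1, 1})"

definition reduced ::
    "nat \<Rightarrow> (nat \<Rightarrow> real) \<Rightarrow> (nat \<Rightarrow> complex set) \<Rightarrow> (nat \<Rightarrow> complex set) \<Rightarrow> bool" where
  "reduced n p \<Delta> \<Gamma> \<longleftrightarrow> transverse n p \<Delta> \<Gamma> \<and> \<not> (\<exists>U. D_disk n p \<Delta> \<Gamma> U)"


section \<open>The ordering\<close>

definition upper_component ::
    "nat \<Rightarrow> (nat \<Rightarrow> real) \<Rightarrow> (nat \<Rightarrow> complex set) \<Rightarrow> complex set" where
  "upper_component n p \<Gamma> =
     connected_component_set (punctured_disk n p - (\<Union>j\<in>{1..n+1}. \<Gamma> j)) \<i>"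

definition lower_component ::
    "nat \<Rightarrow> (nat \<Rightarrow> real) \<Rightarrow> (nat \<Rightarrow> complex set) \<Rightarrow> complex set" where
  "lower_component n p \<Gamma> =
     connected_component_set (punctured_disk n p - (\<Union>j\<in>{1..n+1}. \<Gamma> j)) (- \<i>)"

text \<open>\<open>W\<close> contains an initial piece of the first curve of the diagram of \<open>d\<close> that differs from the
  corresponding curve of the diagram of \<open>g\<close>.  The coherent orientation of the diagram
  of \<open>d\<close> as a path from \<open>-1\<close> to \<open>1\<close> is the image under \<open>d\<close> of the orientation of the real axis.\<close>

definition first_branches_into ::
    "nat \<Rightarrow> (nat \<Rightarrow> real) \<Rightarrow> (complex \<Rightarrow> complex) \<Rightarrow> (complex \<Rightarrow> complex) \<Rightarrow> complex set \<Rightarrow> bool" where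
  "first_branches_into n p d g W \<longleftrightarrow>
     (\<exists>i\<in>{1..n+1}.
        curve_diagram n p d i \<noteq> curve_diagram n p g i \<and>
        (\<forall>j\<in>{1..<i}. curve_diagram n p d j = curve_diagram n p g j) \<and>
        (\<forall>\<^sub>F x in at_right (p (i - 1)). d (complex_of_real x) \<in> W))"

inductive braid_less ::
    "nat \<Rightarrow> (nat \<Rightarrow> real) \<Rightarrow> (complex \<Rightarrow> complex) set \<Rightarrow> (complex \<Rightarrow> complex) set \<Rightarrow> bool"
  for n :: nat and p :: "nat \<Rightarrow> real"
  where
    upper: "braid_less n p \<gamma> \<delta>"
      if "\<gamma> \<in> carrier (braid_group n p)" "\<delta> \<in> carrier (braid_group n p)" "g \<in> \<gamma>" "d \<in> \<delta>"
        "reduced n p (curve_diagram n p d) (curve_diagram n p g)"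
        "first_branches_into n p d g (upper_component n p (curve_diagram n p g))"
  | lower: "braid_less n p \<delta> \<gamma>"
      if "\<gamma> \<in> carrier (braid_group n p)" "\<delta> \<in> carrier (braid_group n p)" "g \<in> \<gamma>" "d \<in> \<delta>"
        "reduced n p (curve_diagram n p d) (curve_diagram n p g)"
        "first_branches_into n p d g (lower_component n p (curve_diagram n p g))"

end

theory Submission
  imports Defs
begin

text \<open>Multiplying by \<open>\<sigma>\<close> on the right means applying a homeomorphism \<open>s\<close> representing \<open>\<sigma>\<close> after the
  representatives of \<open>\<gamma>\<close> and \<open>\<delta>\<close>, hence moving both curve diagrams by \<open>s\<close>.  All data that define
  the ordering are topological and so are transported by \<open>s\<close>: since \<open>s\<close> fixes the boundary, it
  fixes \<open>\<plusminus>1\<close> and preserves upper and lower components.  The only point that is not immediate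
  concerns \<open>D\<close>-disks, whose boundary may contain holes: \<open>s\<close> extends to a homeomorphism of the
  closed disk that permutes the holes.\<close>

section \<open>Extending homeomorphisms over punctures\<close>

text \<open>Provides a uniform scale for the punctures: balls of at most half this radius around
  distinct ones are disjoint.\<close>

lemma finite_separation:
  fixes F :: "'a::metric_space set"
  assumes "finite F"
  obtains \<delta> where "\<delta> > 0" "\<And>x y. x \<in> F \<Longrightarrow> y \<in> F \<Longrightarrow> x \<noteq> y \<Longrightarrow> \<delta> \<le> dist x y"
proof -
  obtain d where d: "\<And>a. a \<in> F \<Longrightarrow> 0 < d a \<and> (\<forall>x\<in>F. x \<noteq> a \<longrightarrow> d a \<le> dist a x)"
    using finite_set_avoid[OF assms] by metis
  show thesis
  proof
    \<comment> \<open>The element 1 keeps the minimum well defined when \<open>F\<close> is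
      empty.\<close>
    show "Min (insert 1 (d ` F)) > 0"
      using assms d by simp
    show "Min (insert 1 (d ` F)) \<le> dist x y" if "x \<in> F" "y \<in> F" "x \<noteq> y" for x y
      using assms d[OF that(1)] that by (intro order_trans[OF Min_le, of _ "d x"]) auto
  qed
qed

text \<open>The punctured neighbourhoods of a puncture leave every compact part of \<open>K - F\<close>, and being
  connected they end up close to a single puncture.\<close>

lemma homeomorphism_tendsto_puncture:
  fixes K F :: "'a::euclidean_space set"
  assumes "compact K" "finite F" "F \<subseteq> interior K" "2 \<le> DIM('a)"
    and fg: "homeomorphism (K - F) (K - F) f g" and "q \<in> F"
  obtains l where "l \<in> F" "(f \<longlongrightarrow> l) (at q)"
proof -
  obtain \<delta> where \<delta>: "\<delta> > 0" "\<And>x y. x \<in> F \<Longrightarrow> y \<in> F \<Longrightarrow> x \<noteq> y \<Longrightarrow> \<delta> \<le> dist x y"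
    using finite_separation[OF \<open>finite F\<close>] by metis
  have fim: "f ` (K - F) = K - F" and gim: "g ` (K - F) = K - F"
    and cf: "continuous_on (K - F) f" and cg: "continuous_on (K - F) g"
    and gf: "\<And>x. x \<in> K - F \<Longrightarrow> g (f x) = x"
    using fg by (auto simp: homeomorphism_def)
  have near: "\<exists>p\<in>F. \<exists>r>0. f ` (ball q r - {q}) \<subseteq> ball p e" if e: "0 < e" "2 * e \<le> \<delta>" for e
  proof -
    \<comment> \<open>The preimage of the compact set \<open>L\<close> under \<open>f\<close> is
      compact and misses \<open>q\<close>. A small ball around \<open>q\<close> therefore avoids it,
      and \<open>f\<close> maps the punctured ball close to the punctures.\<close>
    define L where "L = K - (\<Union>p\<in>F. ball p e)"
    have "L \<subseteq> K - F"
      using e by (auto simp: L_def)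
    have "compact L"
      unfolding L_def using \<open>compact K\<close> by (intro compact_diff) auto
    then have "compact (g ` L)"
      using cg \<open>L \<subseteq> K - F\<close> by (metis compact_continuous_image continuous_on_subset)
    then have "open (interior K - g ` L - (F - {q}))"
      using \<open>finite F\<close> by (intro open_Diff open_interior) (auto simp: compact_imp_closed finite_imp_closed)
    moreover have "q \<in> interior K - g ` L - (F - {q})"
      using \<open>q \<in> F\<close> \<open>F \<subseteq> interior K\<close> \<open>L \<subseteq> K - F\<close> gim by blast
    ultimately obtain r where r: "r > 0" "ball q r \<subseteq> interior K - g ` L - (F - {q})"
      using openE by blast
    have sub: "ball q r - {q} \<subseteq> K - F"
      using r(2) interior_subset by blast
    have union: "f ` (ball q r - {q}) \<subseteq> (\<Union>p\<in>F. ball p e)"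
    proof (rule image_subsetI)
      fix x assume x: "x \<in> ball q r - {q}"
      then have "x \<in> K - F" using sub by blast
      then have "f x \<notin> L" using x r(2) gf by (metis DiffD1 DiffD2 imageI subsetD)
      then show "f x \<in> (\<Union>p\<in>F. ball p e)"
        using \<open>x \<in> K - F\<close> fim by (auto simp: L_def)
    qed
    \<comment> \<open>This is where the dimension bound enters: a punctured ball is connected only
      in dimension at least 2.\<close>
    have conn: "connected (f ` (ball q r - {q}))"
      using connected_punctured_ball[OF assms(4)] cf sub
      by (metis connected_continuous_image continuous_on_subset)
    have "ball q r - {q} \<noteq> {}"
      using r(1) islimpt_ball[of q q r] by (metis centre_in_cball islimpt_EMPTY islimpt_punctured less_le)
    then obtain p where p: "p \<in> F" "ball p e \<inter> f ` (ball q r - {q}) \<noteq> {}"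
      using union by blast
    \<comment> \<open>A common point puts the two centres closer than \<open>2 * e\<close>, which is
      at most \<open>\<delta>\<close>.\<close>
    have "dist x y < \<delta>" if "z \<in> ball x e" "z \<in> ball y e" for x y z
      using dist_triangle2[of x y z] that e by simp
    then have "ball p e \<inter> (\<Union>p'\<in>F - {p}. ball p' e) = {}"
      using \<delta>(2) p(1) by (fastforce simp: not_le[symmetric] simp del: mem_ball)
    moreover have "open (\<Union>p'\<in>F - {p}. ball p' e)"
      by auto
    moreover have "f ` (ball q r - {q}) \<subseteq> ball p e \<union> (\<Union>p'\<in>F - {p}. ball p' e)"
      using union by blast
    ultimately have "(\<Union>p'\<in>F - {p}. ball p' e) \<inter> f ` (ball q r - {q}) = {}"
      using connectedD[OF conn open_ball, of "\<Union>p'\<in>F - {p}. ball p' e" p e] p(2) by blast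
    then show ?thesis
      using union p(1) r(1) by blast
  qed
  have ev: "\<exists>p\<in>F. \<forall>\<^sub>F x in at q. dist (f x) p < e" if e: "0 < e" "2 * e \<le> \<delta>" for e
  proof -
    obtain p r where "p \<in> F" "r > 0" "f ` (ball q r - {q}) \<subseteq> ball p e"
      using near[OF e] by blast
    then show ?thesis
      by (intro bexI[of _ p]) (auto simp: eventually_at dist_commute image_subset_iff intro!: exI[of _ r])
  qed
  \<comment> \<open>The puncture found at scale \<open>\<delta> / 2\<close> is the candidate limit.
    At a smaller scale another puncture might appear, but both are within
    \<open>\<delta> / 2\<close> of \<open>f x\<close> for \<open>x\<close> near \<open>q\<close>, so
    separation makes them equal.\<close>
  obtain l where l: "l \<in> F" "\<forall>\<^sub>F x in at q. dist (f x) l < \<delta> / 2"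
    using ev[of "\<delta> / 2"] \<delta>(1) by auto
  have "(f \<longlongrightarrow> l) (at q)"
  proof (rule tendstoI)
    fix e :: real assume "e > 0"
    then obtain p where p: "p \<in> F" "\<forall>\<^sub>F x in at q. dist (f x) p < min e (\<delta> / 2)"
      using ev[of "min e (\<delta> / 2)"] \<delta>(1) by (metis half_gt_zero_iff min.cobounded2 min_less_iff_conj mult.commute pos_le_divide_eq zero_less_numeral)
    have "\<forall>\<^sub>F x in at q. dist p l < \<delta>"
      using l(2) p(2) by eventually_elim (smt (verit) dist_triangle3 field_sum_of_halves)
    then have "p = l"
      using \<delta>(2) p(1) l(1) by (auto simp: not_le[symmetric])
    then show "\<forall>\<^sub>F x in at q. dist (f x) l < e"
      using p(2) by (auto elim: eventually_mono)
  qed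
  with l(1) show thesis ..
qed

text \<open>The limits at the punctures extend both the map and its inverse continuously. The
  extensions are still mutually inverse, because both composites are the identity on
  \<open>K - F\<close>, which is dense in \<open>K\<close>.\<close>

lemma homeomorphism_extend_punctures:
  fixes K F :: "'a::euclidean_space set"
  assumes K: "compact K" "finite F" "F \<subseteq> interior K" "2 \<le> DIM('a)"
    and fg: "homeomorphism (K - F) (K - F) f g"
  obtains f' g' where "homeomorphism K K f' g'" "f' ` F = F" "\<And>x. x \<in> K - F \<Longrightarrow> f' x = f x"
proof -
  \<comment> \<open>Stated for an arbitrary pair, since it is applied to \<open>f\<close> and to its
    inverse \<open>g\<close>.\<close>
  have extend: "\<exists>h'. continuous_on K h' \<and> h' ` K \<subseteq> K \<and> h' ` F \<subseteq> F \<and> (\<forall>x\<in>K - F. h' x = h x)"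
    if hk: "homeomorphism (K - F) (K - F) h k" for h k
  proof -
    have "\<exists>l. l \<in> F \<and> (h \<longlongrightarrow> l) (at q)" if "q \<in> F" for q
      using homeomorphism_tendsto_puncture[OF K hk that] by blast
    then obtain l where l: "\<And>q. q \<in> F \<Longrightarrow> l q \<in> F \<and> (h \<longlongrightarrow> l q) (at q)"
      by metis
    define h' where "h' x = (if x \<in> F then l x else h x)" for x
    have "(h' \<longlongrightarrow> h' x) (at x within K)" if "x \<in> K" for x
    proof (cases "x \<in> F")
      case True
      \<comment> \<open>Away from the other punctures \<open>h\<close> and \<open>h'\<close> differ
        at most at \<open>x\<close> itself, and the limit at \<open>x\<close> ignores that
        point.\<close>
      have "open (- (F - {x}))"
        using K(2) by (intro open_Compl finite_imp_closed finite_Diff)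
      then have "\<forall>\<^sub>F y in at x. h y = h' y"
        unfolding eventually_at_topological h'_def by (intro exI[of _ "- (F - {x})"]) (auto simp del: Compl_Diff_eq)
      then have "(h' \<longlongrightarrow> l x) (at x)"
        using l[OF True] Lim_transform_eventually by blast
      then show ?thesis
        using tendsto_within_subset[OF _ subset_UNIV] True by (fastforce simp: h'_def)
    next
      case False
      have "continuous_on (K - F) h"
        using hk by (simp add: homeomorphism_def)
      then have "(h \<longlongrightarrow> h x) (at x within (K - F))"
        using that False by (simp add: continuous_on)
      moreover have "at x within (K - F) = at x within K"
        using K(2) False by (intro at_within_nhd[of x "- F"]) (auto simp: finite_imp_closed open_Compl)
      moreover have "\<forall>\<^sub>F y in at x within K. h y = h' y"
        unfolding eventually_at_topological h'_def
        using K(2) False by (intro exI[of _ "- F"]) (auto simp: finite_imp_closed open_Compl)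
      ultimately show ?thesis
        using False Lim_transform_eventually by (fastforce simp: h'_def)
    qed
    moreover have "h' ` F \<subseteq> F" "\<forall>x\<in>K - F. h' x = h x"
      using l by (auto simp: h'_def)
    moreover have "h' ` K \<subseteq> K"
    proof -
      have "F \<subseteq> K" "h ` (K - F) = K - F"
        using K(3) interior_subset hk by (auto simp: homeomorphism_def)
      then show ?thesis using l by (auto simp: h'_def)
    qed
    ultimately show ?thesis
      by (auto simp: continuous_on)
  qed
  obtain f' where f': "continuous_on K f'" "f' ` K \<subseteq> K" "f' ` F \<subseteq> F" "\<And>x. x \<in> K - F \<Longrightarrow> f' x = f x"
    using extend[OF fg] by blast
  obtain g' where g': "continuous_on K g'" "g' ` K \<subseteq> K" "g' ` F \<subseteq> F" "\<And>x. x \<in> K - F \<Longrightarrow> g' x = g x"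
    using extend[OF homeomorphism_symD[OF fg]] by blast
  have inverse: "v (u x) = x"
    if "x \<in> K" "continuous_on K u" "continuous_on K v" "u ` K \<subseteq> K"
      and id: "\<And>y. y \<in> K - F \<Longrightarrow> v (u y) = y" for u v x
  proof -
    have "continuous_on K (\<lambda>y. v (u y) - y)"
      using that by (intro continuous_intros) (auto intro: continuous_on_compose2)
    then have "closed {y \<in> K. v (u y) - y = 0}"
      using K(1) by (intro continuous_closed_preimage_constant) (auto simp: compact_imp_closed)
    moreover have "K - F \<subseteq> {y \<in> K. v (u y) - y = 0}"
      using id by auto
    moreover have "x \<in> closure (K - F)"
    \<comment> \<open>A puncture is interior to \<open>K\<close>, hence a limit point of
      \<open>K\<close>, and it stays one after finitely many points are removed.\<close>
    proof (cases "x \<in> F")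
      case True
      then have "x islimpt K"
        using K(3) interior_limit_point by blast
      moreover have "K \<subseteq> F \<union> (K - F)"
        by blast
      ultimately have "x islimpt F \<union> (K - F)"
        by (rule islimpt_subset)
      then show ?thesis
        using islimpt_Un_finite[OF K(2)] by (simp add: closure_def del: Un_Diff_cancel)
    next
      case False
      then show ?thesis
        using \<open>x \<in> K\<close> closure_subset[of "K - F"] by blast
    qed
    ultimately have "x \<in> {y \<in> K. v (u y) - y = 0}"
      using closure_minimal by blast
    then show ?thesis
      by simp
  qed
  have fg_id: "g' (f' x) = x" "f' (g' x) = x" if "x \<in> K - F" for x
    using that fg f'(4) g'(4) by (metis homeomorphism_def imageI)+
  have gf: "g' (f' x) = x" and fg: "f' (g' x) = x" if "x \<in> K" for x
    using inverse[OF that f'(1) g'(1) f'(2) fg_id(1)] inverse[OF that g'(1) f'(1) g'(2) fg_id(2)]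
    by simp_all
  then have "homeomorphism K K f' g'"
    using f' g' by (intro homeomorphismI) auto
  moreover have "f' ` F = F"
  proof -
    have "F \<subseteq> K"
      using K(3) interior_subset by blast
    \<comment> \<open>\<open>g'\<close> maps \<open>F\<close> into itself, so each puncture is the
      value of \<open>f'\<close> at a puncture.\<close>
    then have "x \<in> f' ` F" if "x \<in> F" for x
      using that g'(3) fg[of x] by (metis image_eqI image_subset_iff subsetD)
    then show ?thesis
      using f'(3) by blast
  qed
  ultimately show thesis
    using f'(4) that by blast
qed


section \<open>Images of curve diagrams\<close>

lemma arc_homeomorphic_image:
  assumes "arc c" "homeomorphism X Y f g" "path_image c \<subseteq> X"
  shows "arc (f \<circ> c)"
proof -
  have "continuous_on (path_image c) f" "inj_on f (path_image c)"
    using assms(2,3) by (auto simp: homeomorphism_def intro: continuous_on_subset inj_on_inverseI)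
  then show ?thesis
    using assms(1) by (auto simp: arc_def path_image_def intro: path_continuous_image comp_inj_on)
qed

text \<open>Invariance of domain. It shows that a D-disk, given only as a set homeomorphic to a
  ball, is open in the plane.\<close>

lemma homeomorphic_open:
  fixes U T :: "'a::euclidean_space set"
  assumes "U homeomorphic T" "open T"
  shows "open U"
proof -
  obtain h k where "homeomorphism T U h k"
    using assms(1) homeomorphic_sym homeomorphic_def by metis
  then show ?thesis
    using invariance_of_domain[of T h] assms(2) by (metis homeomorphism_def inj_on_inverseI)
qed

text \<open>Compactness of \<open>K\<close> makes \<open>f\<close> carry the closure of
  \<open>U\<close> onto the closure of its image, and invariance of domain makes that image open.
  Both frontiers are then closure minus set, and injectivity carries the difference across.\<close>

lemma frontier_homeomorphic_image:
  fixes U :: "'a::euclidean_space set"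
  assumes fg: "homeomorphism K K f g" and "compact K" "open U" "U \<subseteq> K"
  shows "frontier (f ` U) = f ` frontier U"
proof -
  have cf: "continuous_on K f" and inj: "inj_on f K"
    using fg by (auto simp: homeomorphism_def intro: inj_on_inverseI)
  have cl: "closure U \<subseteq> K"
    using assms by (simp add: closure_minimal compact_imp_closed)
  have "compact (f ` closure U)"
    using assms cl cf by (metis bounded_subset closed_closure compact_continuous_image
        compact_eq_bounded_closed continuous_on_subset)
  then have "closure (f ` U) \<subseteq> f ` closure U"
    by (intro closure_minimal image_mono closure_subset compact_imp_closed)
  moreover have "f ` closure U \<subseteq> closure (f ` U)"
    using cf cl by (intro image_closure_subset) (auto intro: continuous_on_subset closure_subset[THEN subsetD])
  moreover have "open (f ` U)"
    using assms cf inj by (metis continuous_on_subset inj_on_subset invariance_of_domain)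
  moreover have "f ` (closure U - U) = f ` closure U - f ` U"
    using inj cl \<open>U \<subseteq> K\<close> by (intro inj_on_image_set_diff) auto
  ultimately show ?thesis
    using \<open>open U\<close> by (simp add: frontier_def interior_open)
qed

lemma image_connected_component_subset:
  assumes "continuous_on X f" "f ` X \<subseteq> Y"
  shows "f ` connected_component_set X x \<subseteq> connected_component_set Y (f x)"
proof (cases "x \<in> X")
  case True
  show ?thesis
  proof (rule connected_component_maximal)
    show "f x \<in> f ` connected_component_set X x"
      using True by auto
    show "connected (f ` connected_component_set X x)"
      using assms(1) by (meson connected_component_subset connected_connected_component
          connected_continuous_image continuous_on_subset)
    show "f ` connected_component_set X x \<subseteq> Y"
      using assms(2) connected_component_subset by fastforce
  qed
next
  case False
  then show ?thesis
    by (simp add: connected_component_eq_empty[THEN iffD2])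
qed

section \<open>Boundary-fixing homeomorphisms of the punctured disk\<close>

lemma disk_homeo_inverse:
  assumes "marked_points n p" "fixes_boundary_homeo n p f"
  obtains g where "homeomorphism (punctured_disk n p) (punctured_disk n p) f g"
    "fixes_boundary_homeo n p g"
proof -
  obtain g where g: "homeomorphism (punctured_disk n p) (punctured_disk n p) f g"
    and bd: "\<forall>z\<in>sphere 0 1. f z = z"
    using assms by (auto simp: fixes_boundary_homeo_def)
  have "g z = z" if "z \<in> sphere 0 1" for z
    using g bd that sphere_subset_punctured_disk[OF assms(1)] by (metis homeomorphism_def subsetD)
  then have "fixes_boundary_homeo n p g"
    using homeomorphism_symD[OF g] by (auto simp: fixes_boundary_homeo_def)
  with g show thesis ..
qed

lemma disk_homeo_inj_on: "fixes_boundary_homeo n p f \<Longrightarrow> inj_on f (punctured_disk n p)"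
  by (auto simp: fixes_boundary_homeo_def homeomorphism_def intro: inj_on_inverseI)

lemma disk_homeo_fixes_endpoints:
  assumes "fixes_boundary_homeo n p f"
  shows "f (-1) = -1" "f 1 = 1"
  using assms by (auto simp: fixes_boundary_homeo_def)

text \<open>The holes form a finite set in the interior of the closed disk, which is the setting of
  \<open>homeomorphism_extend_punctures\<close>.\<close>

lemma disk_homeo_extend:
  assumes "marked_points n p" "fixes_boundary_homeo n p f"
  obtains h k where "homeomorphism (cball 0 1) (cball 0 1) h k" "h ` holes n p = holes n p"
    "\<And>z. z \<in> punctured_disk n p \<Longrightarrow> h z = f z"
proof -
  obtain g where "homeomorphism (cball 0 1 - holes n p) (cball 0 1 - holes n p) f g"
    using assms(2) by (auto simp: fixes_boundary_homeo_def punctured_disk_def)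
  moreover have "holes n p \<subseteq> interior (cball 0 1)"
  proof -
    have "holes n p \<inter> sphere 0 1 = {}"
      using sphere_subset_punctured_disk[OF assms(1)] by (auto simp: punctured_disk_def)
    moreover have "holes n p \<subseteq> cball 0 1"
    proof -
      have "-1 \<le> p j \<and> p j \<le> 1" if "j \<in> {1..n}" for j
        using assms(1) that strict_mono_onD[of "{0..n+1}" p 0 j] strict_mono_onD[of "{0..n+1}" p j "n+1"]
        by (auto simp: marked_points_def)
      then show ?thesis
        by (force simp: holes_def abs_le_iff)
    qed
    ultimately show ?thesis
      by (force simp: less_le)
  qed
  moreover have "finite (holes n p)"
    by (simp add: holes_def)
  ultimately show thesis
    using homeomorphism_extend_punctures[of "cball 0 1" "holes n p" f g] that
    by (auto simp: punctured_disk_def)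
qed

section \<open>Transversality\<close>

text \<open>A chart \<open>h\<close> at \<open>x\<close> becomes the chart
  \<open>h \<circ> g\<close> at \<open>f x\<close>, where \<open>g\<close> inverts \<open>f\<close>;
  its domain is open by invariance of domain.\<close>

lemma crosses_at_image:
  assumes f: "fixes_boundary_homeo n p f" and "A \<subseteq> punctured_disk n p" "B \<subseteq> punctured_disk n p"
    and "crosses_at n p A B x"
  shows "crosses_at n p (f ` A) (f ` B) (f x)"
proof -
  let ?D = "punctured_disk n p"
  obtain g where g: "homeomorphism ?D ?D f g"
    using f by (auto simp: fixes_boundary_homeo_def)
  obtain U h k where U: "open U" "x \<in> U" "U \<subseteq> ?D" "homeomorphism U (ball 0 1) h k" "h x = 0"
    "h ` (A \<inter> U) = {z \<in> ball 0 1. Im z = 0}" "h ` (B \<inter> U) = {z \<in> ball 0 1. Re z = 0}"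
    using assms(4) by (auto simp: crosses_at_def)
  have gf: "g (f y) = y" if "y \<in> ?D" for y
    using g that by (simp add: homeomorphism_def)
  have "homeomorphism (f ` U) U g f"
    using g U(3) by (intro homeomorphism_symD[OF homeomorphism_of_subsets[OF g]]) (auto simp: homeomorphism_def)
  then have "homeomorphism (f ` U) (ball 0 1) (h \<circ> g) (f \<circ> k)"
    using U(4) homeomorphism_compose by blast
  moreover have "open (f ` U)"
    using U(1,3) g disk_homeo_inj_on[OF f]
    by (metis continuous_on_subset homeomorphism_def inj_on_subset invariance_of_domain)
  moreover have "(h \<circ> g) ` (f ` C \<inter> f ` U) = h ` (C \<inter> U)" if "C \<subseteq> ?D" for C
  proof -
    have "f ` C \<inter> f ` U = f ` (C \<inter> U)"
      using inj_on_image_Int[OF disk_homeo_inj_on[OF f] that U(3)] by simp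
    moreover have "g ` f ` (C \<inter> U) = C \<inter> U"
      using that gf by (force simp: image_iff)
    ultimately show ?thesis
      by (simp only: image_comp[symmetric])
  qed
  moreover have "f ` U \<subseteq> ?D"
    using g U(3) by (auto simp: homeomorphism_def)
  ultimately show ?thesis
    unfolding crosses_at_def using U assms(2,3) gf
    by (intro exI[of _ "f ` U"] exI[of _ "h \<circ> g"] exI[of _ "f \<circ> k"]) auto
qed

text \<open>By injectivity the intersection points correspond. The exempt points \<open>-1\<close>
  and \<open>1\<close> are fixed by \<open>f\<close>, so every other intersection point of the
  images comes from one with a crossing.\<close>

lemma meets_transversely_image:
  assumes f: "fixes_boundary_homeo n p f" and AB: "A \<subseteq> punctured_disk n p" "B \<subseteq> punctured_disk n p"
    and "meets_transversely n p A B"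
  shows "meets_transversely n p (f ` A) (f ` B)"
proof -
  have "f ` A \<inter> f ` B = f ` (A \<inter> B)"
    using inj_on_image_Int[OF disk_homeo_inj_on[OF f] AB] by simp
  then show ?thesis
    using assms(4) disk_homeo_fixes_endpoints[OF f]
    by (auto simp: meets_transversely_def intro: crosses_at_image[OF f AB])
qed

lemma transverse_image:
  assumes "fixes_boundary_homeo n p f"
    and "\<And>j. \<Delta> j \<subseteq> punctured_disk n p" "\<And>j. \<Gamma> j \<subseteq> punctured_disk n p"
    and "transverse n p \<Delta> \<Gamma>"
  shows "transverse n p (\<lambda>j. f ` \<Delta> j) (\<lambda>j. f ` \<Gamma> j)"
  unfolding transverse_def
proof
  fix j assume "j \<in> {1..n+1}"
  then consider k where "k \<in> {1..n+1}" "\<Delta> j = \<Gamma> k" |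
    "\<forall>k\<in>{1..n+1}. meets_transversely n p (\<Delta> j) (\<Gamma> k)"
    using assms(4) unfolding transverse_def by blast
  then show "(\<exists>k\<in>{1..n+1}. f ` \<Delta> j = f ` \<Gamma> k) \<or>
      (\<forall>k\<in>{1..n+1}. meets_transversely n p (f ` \<Delta> j) (f ` \<Gamma> k))"
    by cases (auto intro: meets_transversely_image[OF assms(1-3)])
qed

section \<open>D-disks and reducedness\<close>

text \<open>Only the interior of the segment is known to lie in \<open>A\<close>. The end points may
  be holes, so they are placed in \<open>K\<close> separately to get the whole arc into the domain
  of \<open>h\<close>.\<close>

lemma open_segment_of_image:
  assumes hk: "homeomorphism K L h k" and "closed K" "A \<subseteq> K" "a \<in> K" "b \<in> K"
    and "open_segment_of A S a b"
  shows "open_segment_of (h ` A) (h ` S) (h a) (h b)"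
proof -
  obtain c where c: "arc c" "pathstart c = a" "pathfinish c = b" "S = c ` {0<..<1}" "S \<subseteq> A"
    using assms(6) by (auto simp: open_segment_of_def)
  have "{0..1::real} = insert 0 (insert 1 {0<..<1})"
    by auto
  then have "path_image c \<subseteq> K"
    using c assms(3-5) by (auto simp: path_image_def pathstart_def pathfinish_def)
  then have "arc (h \<circ> c)"
    using arc_homeomorphic_image[OF c(1) hk] by blast
  then show ?thesis
    unfolding open_segment_of_def using c
    by (intro exI[of _ "h \<circ> c"]) (auto simp: pathstart_compose pathfinish_compose)
qed

text \<open>End points of a \<open>D\<close>-disk may be holes, so the homeomorphism has to be extended over the holes
  to move the bounding arcs.\<close>

lemma D_disk_image:
  assumes mp: "marked_points n p" and f: "fixes_boundary_homeo n p f"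
    and sub: "\<And>j. \<Delta> j \<subseteq> punctured_disk n p" "\<And>j. \<Gamma> j \<subseteq> punctured_disk n p"
    and "D_disk n p \<Delta> \<Gamma> U"
  shows "D_disk n p (\<lambda>j. f ` \<Delta> j) (\<lambda>j. f ` \<Gamma> j) (f ` U)"
proof -
  let ?D = "punctured_disk n p" and ?K = "cball 0 1 :: complex set"
  obtain h k where hk: "homeomorphism ?K ?K h k" and holes: "h ` holes n p = holes n p"
    and hf: "\<And>z. z \<in> ?D \<Longrightarrow> h z = f z"
    using disk_homeo_extend[OF mp f] by blast
  \<comment> \<open>Curves and \<open>U\<close> avoid the holes, so there \<open>f\<close> and its
    extension agree. The frontier and the end points may contain holes and are moved by
    \<open>h\<close>.\<close>
  have img: "f ` A = h ` A" if "A \<subseteq> ?D" for A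
    using hf that by (intro image_cong) auto
  have DK: "?D \<subseteq> ?K"
    by (auto simp: punctured_disk_def)
  have inj: "inj_on h ?K"
    using hk by (auto simp: homeomorphism_def intro: inj_on_inverseI)
  have ends: "h (-1) = -1" "h 1 = 1"
    using hf disk_homeo_fixes_endpoints[OF f] sphere_subset_punctured_disk[OF mp]
    by (auto simp: subset_iff)
  obtain j l S T a b where U: "U \<subseteq> ?D" "U homeomorphic (ball 0 1 :: complex set)"
    and jl: "j \<in> {1..n+1}" "l \<in> {1..n+1}"
    and ST: "open_segment_of (\<Delta> j) S a b" "open_segment_of (\<Gamma> l) T a b" "S \<inter> T = {}"
    and fr: "frontier U = S \<union> T \<union> {a, b}"
    and ab: "{a, b} \<subseteq> (\<Delta> j \<inter> \<Gamma> l) \<union> holes n p \<union> {-1, 1}"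
    using assms(5) unfolding D_disk_def by metis
  have "open U"
    using U(2) homeomorphic_open open_ball by blast
  have UK: "U \<subseteq> ?K"
    using U(1) DK by blast
  have "frontier U \<subseteq> ?K"
    using closure_minimal[OF UK closed_cball] by (auto simp: frontier_def)
  then have STK: "S \<subseteq> ?K" "T \<subseteq> ?K" "a \<in> ?K" "b \<in> ?K"
    using fr by auto
  have "homeomorphism U (h ` U) h k"
    using hk UK by (intro homeomorphism_of_subsets[OF hk]) (auto simp: homeomorphism_def)
  then have "h ` U homeomorphic (ball 0 1 :: complex set)"
    using U(2) homeomorphic_def homeomorphic_sym homeomorphic_trans by metis
  moreover have "f ` U \<subseteq> ?D"
    using U(1) f unfolding fixes_boundary_homeo_def homeomorphism_def by blast
  moreover have "open_segment_of (h ` \<Delta> j) (h ` S) (h a) (h b)"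
    "open_segment_of (h ` \<Gamma> l) (h ` T) (h a) (h b)"
    using STK ST by (intro open_segment_of_image[OF hk] closed_cball subset_trans[OF sub(1) DK]
        subset_trans[OF sub(2) DK]; simp)+
  moreover have "h ` S \<inter> h ` T = {}"
    using inj_on_image_Int[OF inj STK(1,2)] ST(3) by simp
  moreover have "frontier (h ` U) = h ` S \<union> h ` T \<union> {h a, h b}"
    using frontier_homeomorphic_image[OF hk compact_cball \<open>open U\<close> UK] fr by auto
  \<comment> \<open>Each kind of admissible end point is preserved: common points of the curves,
    holes, and the fixed points \<open>-1\<close> and \<open>1\<close>.\<close>
  moreover have "{h a, h b} \<subseteq> (h ` \<Delta> j \<inter> h ` \<Gamma> l) \<union> holes n p \<union> {-1, 1}"
    using ab ends holes by blast
  ultimately show ?thesis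
    unfolding D_disk_def img[OF U(1)] img[OF sub(1)] img[OF sub(2)]
    by (intro conjI bexI[OF _ jl(1)] bexI[OF _ jl(2)] exI[of _ "h ` S"] exI[of _ "h ` T"]
        exI[of _ "h a"] exI[of _ "h b"])
qed

text \<open>The inverse homeomorphism would pull a D-disk between the image diagrams back to one
  between the original diagrams.\<close>

lemma reduced_image:
  assumes mp: "marked_points n p" and f: "fixes_boundary_homeo n p f"
    and sub: "\<And>j. \<Delta> j \<subseteq> punctured_disk n p" "\<And>j. \<Gamma> j \<subseteq> punctured_disk n p"
    and "reduced n p \<Delta> \<Gamma>"
  shows "reduced n p (\<lambda>j. f ` \<Delta> j) (\<lambda>j. f ` \<Gamma> j)"
proof -
  let ?D = "punctured_disk n p"
  obtain g where fg: "homeomorphism ?D ?D f g" and g: "fixes_boundary_homeo n p g"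
    using disk_homeo_inverse[OF mp f] .
  have gf: "g ` f ` A = A" if "A \<subseteq> ?D" for A
  proof -
    have "g (f x) = x" if "x \<in> A" for x
      using fg \<open>A \<subseteq> ?D\<close> that by (auto simp: homeomorphism_def)
    then show ?thesis
      by (simp add: image_image)
  qed
  have "f ` A \<subseteq> ?D" if "A \<subseteq> ?D" for A
    using fg that by (auto simp: homeomorphism_def)
  then have "D_disk n p \<Delta> \<Gamma> (g ` U)" if "D_disk n p (\<lambda>j. f ` \<Delta> j) (\<lambda>j. f ` \<Gamma> j) U" for U
    using D_disk_image[OF mp g _ _ that] sub by (simp add: gf)
  moreover have "transverse n p (\<lambda>j. f ` \<Delta> j) (\<lambda>j. f ` \<Gamma> j)"
    using assms(5) unfolding reduced_def by (intro transverse_image[OF f sub]) auto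
  ultimately show ?thesis
    using assms(5) unfolding reduced_def by blast
qed

section \<open>Branching and the two components\<close>

lemma curve_diagram_compose:
  "curve_diagram n p (compose (punctured_disk n p) f g) = (\<lambda>j. f ` curve_diagram n p g j)"
  by (auto simp: curve_diagram_def compose_def fun_eq_iff image_iff)

lemma curve_diagram_subset:
  "g \<in> disk_homeos n p \<Longrightarrow> curve_diagram n p g j \<subseteq> punctured_disk n p"
  using disk_homeos_into by (auto simp: curve_diagram_def)

text \<open>Injectivity preserves the first index at which the diagrams differ, and the initial
  piece of that curve moves along with \<open>f\<close>.\<close>

lemma first_branches_into_compose:
  assumes mp: "marked_points n p" and f: "fixes_boundary_homeo n p f"
    and dg: "d \<in> disk_homeos n p" "g \<in> disk_homeos n p"
    and "first_branches_into n p d g V" "f ` V \<subseteq> W"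
  shows "first_branches_into n p (compose (punctured_disk n p) f d) (compose (punctured_disk n p) f g) W"
proof -
  let ?D = "punctured_disk n p"
  obtain i where i: "i \<in> {1..n+1}" "curve_diagram n p d i \<noteq> curve_diagram n p g i"
    "\<forall>j\<in>{1..<i}. curve_diagram n p d j = curve_diagram n p g j"
    "\<forall>\<^sub>F x in at_right (p (i - 1)). d (complex_of_real x) \<in> V"
    using assms(5) unfolding first_branches_into_def by blast
  have mono: "strict_mono_on {0..n+1} p" and p01: "p 0 = -1" "p (n+1) = 1"
    using mp by (auto simp: marked_points_def)
  have le: "p a \<le> p b" if "a \<le> b" "b \<le> n + 1" for a b
    using that by (cases "a = b") (use strict_mono_onD[OF mono, of a b] in auto)
  \<comment> \<open>No hole lies strictly between consecutive marked points. Hence on this interval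
    \<open>compose\<close> is genuine composition and not its default value.\<close>
  have inD: "complex_of_real x \<in> ?D" if "x \<in> {p (i - 1)<..<p i}" for x
  proof -
    have "-1 \<le> p (i - 1)" "p i \<le> 1"
      using le[of 0 "i - 1"] le[of i "n + 1"] i(1) p01 by auto
    moreover have "p j \<le> p (i - 1) \<or> p i \<le> p j" if "j \<in> {1..n}" for j
      using le[of j "i - 1"] le[of i j] i(1) that by force
    ultimately show ?thesis
      using that by (force simp: punctured_disk_def holes_def abs_le_iff)
  qed
  have "p (i - 1) < p i"
    using strict_mono_onD[OF mono, of "i - 1" i] i(1) by auto
  then have "\<forall>\<^sub>F x in at_right (p (i - 1)). x \<in> {p (i - 1)<..<p i}"
    by (rule eventually_at_right_real)
  then have "\<forall>\<^sub>F x in at_right (p (i - 1)). compose ?D f d (complex_of_real x) \<in> W"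
    using i(4) by eventually_elim (use inD assms(6) in \<open>auto simp: compose_def\<close>)
  moreover have "f ` A = f ` B \<longleftrightarrow> A = B" if "A \<subseteq> ?D" "B \<subseteq> ?D" for A B
    using inj_on_image_eq_iff[OF disk_homeo_inj_on[OF f] that] .
  ultimately show ?thesis
    unfolding first_branches_into_def curve_diagram_compose
    using i dg by (intro bexI[of _ i]) (auto simp: curve_diagram_subset)
qed

text \<open>Connected sets have connected images, and the base point stays put because it lies on
  the boundary circle.\<close>

lemma component_image_subset:
  assumes f: "fixes_boundary_homeo n p f" and sub: "\<And>j. \<Gamma> j \<subseteq> punctured_disk n p"
    and "z \<in> sphere 0 1"
  shows "f ` connected_component_set (punctured_disk n p - (\<Union>j\<in>{1..n+1}. \<Gamma> j)) z \<subseteq>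
         connected_component_set (punctured_disk n p - (\<Union>j\<in>{1..n+1}. f ` \<Gamma> j)) z"
proof -
  let ?D = "punctured_disk n p" and ?X = "punctured_disk n p - (\<Union>j\<in>{1..n+1}. \<Gamma> j)"
  obtain g where fg: "homeomorphism ?D ?D f g" and "f z = z"
    using f assms(3) by (auto simp: fixes_boundary_homeo_def)
  have "continuous_on ?X f"
    using fg by (metis Diff_subset continuous_on_subset homeomorphism_def)
  moreover have "f ` ?X \<subseteq> ?D - (\<Union>j\<in>{1..n+1}. f ` \<Gamma> j)"
    using fg sub by (simp add: homeomorphism_def image_UN[symmetric])
      (metis (lifting) UN_least inj_on_image_set_diff[OF disk_homeo_inj_on[OF f]] Diff_subset order_refl)
  ultimately show ?thesis
    using image_connected_component_subset \<open>f z = z\<close> by metis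
qed

theorem proposition3p2:
  fixes n :: nat and p :: "nat \<Rightarrow> real" and \<gamma> \<delta> \<sigma> :: "(complex \<Rightarrow> complex) set"
  assumes "marked_points n p"
    and "\<gamma> \<in> carrier (braid_group n p)"
    and "\<delta> \<in> carrier (braid_group n p)"
    and "\<sigma> \<in> carrier (braid_group n p)"
    and "braid_less n p \<delta> \<gamma>"
  shows "braid_less n p (\<delta> \<otimes>\<^bsub>braid_group n p\<^esub> \<sigma>) (\<gamma> \<otimes>\<^bsub>braid_group n p\<^esub> \<sigma>)"
proof -
  note mp = assms(1)
  let ?D = "punctured_disk n p"
  interpret group "braid_group n p"
    using group_braid_group[OF mp] .
  obtain s where "s \<in> disk_homeos n p" and \<sigma>: "\<sigma> = isotopy_rel n p `` {s}"
    using assms(4) by (auto simp: braid_group_def quotient_def)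
  then have s: "s \<in> disk_homeos n p" "fixes_boundary_homeo n p s"
    by (auto simp: disk_homeos_def)
  \<comment> \<open>The left factor of a product acts first, so \<open>s\<close> is composed on the
    outside. Any member of a class may serve as its representative.\<close>
  have rep: "h \<in> disk_homeos n p" "compose ?D s h \<in> \<eta> \<otimes>\<^bsub>braid_group n p\<^esub> \<sigma>"
    if "\<eta> \<in> carrier (braid_group n p)" "h \<in> \<eta>" for \<eta> h
  proof -
    have h: "h \<in> disk_homeos n p" "\<eta> = isotopy_rel n p `` {h}"
      using that equiv_isotopy_rel[of n p] unfolding braid_group_def
      by (auto simp: quotient_def isotopy_rel_def[of n p] intro: equiv_class_eq dest: equiv_class_eq)
    show "h \<in> disk_homeos n p"
      by (fact h(1))
    show "compose ?D s h \<in> \<eta> \<otimes>\<^bsub>braid_group n p\<^esub> \<sigma>"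
      using braid_group_mult_class[OF mp h(1) s(1)] h(2) \<sigma>
        equiv_class_self[OF equiv_isotopy_rel disk_homeos_compose[OF mp s(1) h(1)]] by simp
  qed
  have red: "reduced n p (curve_diagram n p (compose ?D s d)) (curve_diagram n p (compose ?D s g))"
    if "reduced n p (curve_diagram n p d) (curve_diagram n p g)" "d \<in> disk_homeos n p" "g \<in> disk_homeos n p"
    for d g
    unfolding curve_diagram_compose using that by (intro reduced_image[OF mp s(2)] curve_diagram_subset)
  have comp: "s ` upper_component n p (curve_diagram n p g) \<subseteq>
       upper_component n p (curve_diagram n p (compose ?D s g))"
    "s ` lower_component n p (curve_diagram n p g) \<subseteq>
       lower_component n p (curve_diagram n p (compose ?D s g))"
    if "g \<in> disk_homeos n p" for g
    unfolding upper_component_def lower_component_def curve_diagram_compose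
    using that by (intro component_image_subset[OF s(2)] curve_diagram_subset; simp)+
  show ?thesis
    using assms(5)
  proof cases
    case (upper g d)
    note r = rep[OF upper(1,3)] rep[OF upper(2,4)]
    show ?thesis
      using upper r assms(4) red comp first_branches_into_compose[OF mp s(2)]
      by (intro braid_less.upper[of _ _ _ _ "compose ?D s g" "compose ?D s d"]) (auto intro!: m_closed)
  next
    \<comment> \<open>The roles are exchanged: here \<open>g\<close> represents
      \<open>\<gamma>\<close> and \<open>d\<close> represents \<open>\<delta>\<close>, whose diagram
      branches into the lower component.\<close>
    case (lower g d)
    note r = rep[OF lower(1,3)] rep[OF lower(2,4)]
    show ?thesis
      using lower r assms(4) red comp first_branches_into_compose[OF mp s(2)]
      by (intro braid_less.lower[of _ _ _ _ "compose ?D s g" "compose ?D s d"]) (auto intro!: m_closed)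
  qed
qed

end
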